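(* Let $R$ be a ring, let $s,t\in C(R)\cap U(R)$, and let $S=H_{(s,t)}(R)$. Then $S$ is $\Delta$-quasipolar if and only if $R$ is $\Delta$-quasipolar.
   Context: All rings are associative and unital; $U(T)$ is the group of units and $C(T)$ the center of a ring $T$. For $s,t\in C(R)\cap U(R)$, $H_{(s,t)}(R)$ is the subring of $M_3(R)$ given by $$H_{(s,t)}(R)=\left\{\begin{bmatrix}a&0&0\\c&d&e\\0&0&f\end{bmatrix}\in M_3(R)\ \middle|\ a,c,d,e,f\in R,\ a-d=sc,\ d-f=te\right\}.$$ For a ring $T$, $\Delta(T)=\{r\in T \mid r+u\in U(T)\text{ for all }u\in U(T)\}$. For $a\in T$, $comm(a)=\{x\in T\mid ax=xa\}$ and $comm^2(a)=\{y\in T\mid xy=yx\text{ for all }x\in comm(a)\}$. An element $a\in T$ is $\Delta$-quasipolar if there exists $p^2=p\in comm^2(a)$ such that $a+p\in\Delta(T)$; $T$ is $\Delta$-quasipolar if every element of $T$ is $\Delta$-quasipolar. *)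

theory Defs
  imports "HOL-Analysis.Cartesian_Space" "HOL-Algebra.Subrings"
begin

definition ring_center :: "('a, 'm) ring_scheme \<Rightarrow> 'a set" where
  "ring_center T = {z \<in> carrier T. \<forall>x \<in> carrier T. z \<otimes>\<^bsub>T\<^esub> x = x \<otimes>\<^bsub>T\<^esub> z}"

definition Delta :: "('a, 'm) ring_scheme \<Rightarrow> 'a set" where
  "Delta T = {r \<in> carrier T. \<forall>u \<in> Units T. r \<oplus>\<^bsub>T\<^esub> u \<in> Units T}"

definition comm :: "('a, 'm) ring_scheme \<Rightarrow> 'a \<Rightarrow> 'a set" where
  "comm T a = {x \<in> carrier T. a \<otimes>\<^bsub>T\<^esub> x = x \<otimes>\<^bsub>T\<^esub> a}"

definition comm2 :: "('a, 'm) ring_scheme \<Rightarrow> 'a \<Rightarrow> 'a set" where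
  "comm2 T a = {y \<in> carrier T. \<forall>x \<in> comm T a. x \<otimes>\<^bsub>T\<^esub> y = y \<otimes>\<^bsub>T\<^esub> x}"

definition Delta_quasipolar_elem :: "('a, 'm) ring_scheme \<Rightarrow> 'a \<Rightarrow> bool" where
  "Delta_quasipolar_elem T a \<longleftrightarrow>
     (\<exists>p \<in> comm2 T a. p \<otimes>\<^bsub>T\<^esub> p = p \<and> a \<oplus>\<^bsub>T\<^esub> p \<in> Delta T)"

definition Delta_quasipolar :: "('a, 'm) ring_scheme \<Rightarrow> bool" where
  "Delta_quasipolar T \<longleftrightarrow> (\<forall>a \<in> carrier T. Delta_quasipolar_elem T a)"

text \<open>
  The library product \<open>**\<close> needs a type-class ring of entries; here the entries lie in the
  carrier of an arbitrary ring \<open>R\<close>.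
\<close>

definition mat_ring :: "('a, 'm) ring_scheme \<Rightarrow> ('a^'n^'n) ring" where
  "mat_ring R =
     \<lparr>carrier = {A. \<forall>i j. A $ i $ j \<in> carrier R},
      mult = (\<lambda>A B. \<chi> i j. \<Oplus>\<^bsub>R\<^esub>k\<in>UNIV. A $ i $ k \<otimes>\<^bsub>R\<^esub> B $ k $ j),
      one = (\<chi> i j. if i = j then \<one>\<^bsub>R\<^esub> else \<zero>\<^bsub>R\<^esub>),
      zero = (\<chi> i j. \<zero>\<^bsub>R\<^esub>),
      add = (\<lambda>A B. \<chi> i j. A $ i $ j \<oplus>\<^bsub>R\<^esub> B $ i $ j)\<rparr>"

lemma (in abelian_monoid) finsum_swap:
  assumes "finite A" "finite B" "\<And>i j. i \<in> A \<Longrightarrow> j \<in> B \<Longrightarrow> f i j \<in> carrier G"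
  shows "(\<Oplus>i\<in>A. \<Oplus>j\<in>B. f i j) = (\<Oplus>j\<in>B. \<Oplus>i\<in>A. f i j)"
  using assms(1,3)
proof (induction rule: finite_induct)
  case empty
  then show ?case by simp
next
  case (insert x F)
  have "(\<Oplus>i\<in>insert x F. \<Oplus>j\<in>B. f i j) = (\<Oplus>j\<in>B. f x j) \<oplus> (\<Oplus>i\<in>F. \<Oplus>j\<in>B. f i j)"
    using insert by (intro finsum_insert) (auto intro!: finsum_closed)
  also have "\<dots> = (\<Oplus>j\<in>B. f x j) \<oplus> (\<Oplus>j\<in>B. \<Oplus>i\<in>F. f i j)"
    using insert by simp
  also have "\<dots> = (\<Oplus>j\<in>B. f x j \<oplus> (\<Oplus>i\<in>F. f i j))"
    using insert by (intro finsum_addf [symmetric]) (auto intro!: finsum_closed)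
  also have "\<dots> = (\<Oplus>j\<in>B. \<Oplus>i\<in>insert x F. f i j)"
    using insert
    by (intro finsum_cong' refl finsum_insert [symmetric])
       (auto intro!: finsum_closed a_closed)
  finally show ?case .
qed

lemma (in ring) mat_ring_is_ring: "ring (mat_ring R :: ('a^'n^'n) ring)"
proof (rule ringI)
  show "abelian_group (mat_ring R :: ('a^'n^'n) ring)"
  proof (rule abelian_groupI)
    fix A :: "'a^'n^'n"
    assume "A \<in> carrier (mat_ring R)"
    then show "\<exists>B \<in> carrier (mat_ring R). B \<oplus>\<^bsub>mat_ring R\<^esub> A = \<zero>\<^bsub>mat_ring R\<^esub>"
      by (intro bexI [of _ "\<chi> i j. \<ominus> (A $ i $ j)"]) (auto simp: mat_ring_def vec_eq_iff l_neg)
  qed (auto simp: mat_ring_def vec_eq_iff a_ac)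
next
  show "monoid (mat_ring R :: ('a^'n^'n) ring)"
  proof (rule monoidI)
    fix A B C :: "'a^'n^'n"
    assume "A \<in> carrier (mat_ring R)" "B \<in> carrier (mat_ring R)" "C \<in> carrier (mat_ring R)"
    then have c: "A $ i $ j \<in> carrier R" "B $ i $ j \<in> carrier R" "C $ i $ j \<in> carrier R" for i j
      by (auto simp: mat_ring_def)
    have "(\<Oplus>k\<in>UNIV. (\<Oplus>l\<in>UNIV. A $ i $ l \<otimes> B $ l $ k) \<otimes> C $ k $ j) =
          (\<Oplus>l\<in>UNIV. A $ i $ l \<otimes> (\<Oplus>k\<in>UNIV. B $ l $ k \<otimes> C $ k $ j))" for i j
    proof -
      have "(\<Oplus>k\<in>UNIV. (\<Oplus>l\<in>UNIV. A $ i $ l \<otimes> B $ l $ k) \<otimes> C $ k $ j) =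
            (\<Oplus>k\<in>UNIV. \<Oplus>l\<in>UNIV. A $ i $ l \<otimes> (B $ l $ k \<otimes> C $ k $ j))"
        using c by (intro finsum_cong' refl) (auto simp: finsum_ldistr m_assoc intro!: finsum_closed)
      also have "\<dots> = (\<Oplus>l\<in>UNIV. \<Oplus>k\<in>UNIV. A $ i $ l \<otimes> (B $ l $ k \<otimes> C $ k $ j))"
        using c by (intro finsum_swap) auto
      also have "\<dots> = (\<Oplus>l\<in>UNIV. A $ i $ l \<otimes> (\<Oplus>k\<in>UNIV. B $ l $ k \<otimes> C $ k $ j))"
        using c by (intro finsum_cong' refl) (auto simp: finsum_rdistr intro!: finsum_closed)
      finally show ?thesis .
    qed
    then show "A \<otimes>\<^bsub>mat_ring R\<^esub> B \<otimes>\<^bsub>mat_ring R\<^esub> C = A \<otimes>\<^bsub>mat_ring R\<^esub> (B \<otimes>\<^bsub>mat_ring R\<^esub> C)"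
      by (simp add: mat_ring_def)
  next
    fix A :: "'a^'n^'n"
    assume "A \<in> carrier (mat_ring R)"
    then have c: "A $ i $ j \<in> carrier R" for i j
      by (auto simp: mat_ring_def)
    have "(\<Oplus>k\<in>UNIV. (if i = k then \<one> else \<zero>) \<otimes> A $ k $ j) = A $ i $ j" for i j
    proof -
      have "(\<Oplus>k\<in>UNIV. (if i = k then \<one> else \<zero>) \<otimes> A $ k $ j) =
            (\<Oplus>k\<in>UNIV. if i = k then A $ k $ j else \<zero>)"
        using c by (intro finsum_cong' refl) auto
      then show ?thesis
        using c by (simp add: finsum_singleton [of i UNIV "\<lambda>k. A $ k $ j"])
    qed
    then show "\<one>\<^bsub>mat_ring R\<^esub> \<otimes>\<^bsub>mat_ring R\<^esub> A = A"
      by (simp add: mat_ring_def vec_eq_iff)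
    have "(\<Oplus>k\<in>UNIV. A $ i $ k \<otimes> (if k = j then \<one> else \<zero>)) = A $ i $ j" for i j
    proof -
      have "(\<Oplus>k\<in>UNIV. A $ i $ k \<otimes> (if k = j then \<one> else \<zero>)) =
            (\<Oplus>k\<in>UNIV. if j = k then A $ i $ k else \<zero>)"
        using c by (intro finsum_cong' refl) auto
      then show ?thesis
        using c by (simp add: finsum_singleton [of j UNIV "\<lambda>k. A $ i $ k"])
    qed
    then show "A \<otimes>\<^bsub>mat_ring R\<^esub> \<one>\<^bsub>mat_ring R\<^esub> = A"
      by (simp add: mat_ring_def vec_eq_iff)
  qed (auto simp: mat_ring_def intro!: finsum_closed)
next
  fix A B C :: "'a^'n^'n"
  assume "A \<in> carrier (mat_ring R)" "B \<in> carrier (mat_ring R)" "C \<in> carrier (mat_ring R)"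
  then have c: "A $ i $ j \<in> carrier R" "B $ i $ j \<in> carrier R" "C $ i $ j \<in> carrier R" for i j
    by (auto simp: mat_ring_def)
  show "(A \<oplus>\<^bsub>mat_ring R\<^esub> B) \<otimes>\<^bsub>mat_ring R\<^esub> C =
        A \<otimes>\<^bsub>mat_ring R\<^esub> C \<oplus>\<^bsub>mat_ring R\<^esub> B \<otimes>\<^bsub>mat_ring R\<^esub> C"
    using c by (simp add: mat_ring_def vec_eq_iff l_distr Pi_def finsum_addf)
  show "C \<otimes>\<^bsub>mat_ring R\<^esub> (A \<oplus>\<^bsub>mat_ring R\<^esub> B) =
        C \<otimes>\<^bsub>mat_ring R\<^esub> A \<oplus>\<^bsub>mat_ring R\<^esub> C \<otimes>\<^bsub>mat_ring R\<^esub> B"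
    using c by (simp add: mat_ring_def vec_eq_iff r_distr Pi_def finsum_addf)
qed

text \<open>
  \<open>H_mat R a c d e f\<close> is the matrix with rows \<open>(a, 0, 0)\<close>, \<open>(c, d, e)\<close>, \<open>(0, 0, f)\<close>.
\<close>

definition H_mat :: "('a, 'm) ring_scheme \<Rightarrow> 'a \<Rightarrow> 'a \<Rightarrow> 'a \<Rightarrow> 'a \<Rightarrow> 'a \<Rightarrow> 'a^3^3" where
  "H_mat R a c d e f =
     (\<chi> i j. if i = 1 then (if j = 1 then a else \<zero>\<^bsub>R\<^esub>)
             else if i = 2 then (if j = 1 then c else if j = 2 then d else e)
             else (if j = 3 then f else \<zero>\<^bsub>R\<^esub>))"

definition H_set :: "('a, 'm) ring_scheme \<Rightarrow> 'a \<Rightarrow> 'a \<Rightarrow> ('a^3^3) set" where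
  "H_set R s t =
     {H_mat R a c d e f | a c d e f.
        {a, c, d, e, f} \<subseteq> carrier R \<and>
        a \<ominus>\<^bsub>R\<^esub> d = s \<otimes>\<^bsub>R\<^esub> c \<and> d \<ominus>\<^bsub>R\<^esub> f = t \<otimes>\<^bsub>R\<^esub> e}"

definition H_ring :: "('a, 'm) ring_scheme \<Rightarrow> 'a \<Rightarrow> 'a \<Rightarrow> ('a^3^3) ring" where
  "H_ring R s t = (mat_ring R)\<lparr>carrier := H_set R s t\<rparr>"

lemma H_mat_nth [simp]:
  "H_mat R a c d e f $ 1 $ 1 = a" "H_mat R a c d e f $ 1 $ 2 = \<zero>\<^bsub>R\<^esub>"
  "H_mat R a c d e f $ 1 $ 3 = \<zero>\<^bsub>R\<^esub>"
  "H_mat R a c d e f $ 2 $ 1 = c" "H_mat R a c d e f $ 2 $ 2 = d"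
  "H_mat R a c d e f $ 2 $ 3 = e"
  "H_mat R a c d e f $ 3 $ 1 = \<zero>\<^bsub>R\<^esub>" "H_mat R a c d e f $ 3 $ 2 = \<zero>\<^bsub>R\<^esub>"
  "H_mat R a c d e f $ 3 $ 3 = f"
  by (simp_all add: H_mat_def)

context ring
begin

lemma H_mat_carrier:
  "{a, c, d, e, f} \<subseteq> carrier R \<Longrightarrow> H_mat R a c d e f \<in> carrier (mat_ring R)"
  by (simp add: mat_ring_def H_mat_def)

lemma finsum_3:
  assumes "\<And>k. g k \<in> carrier R"
  shows "(\<Oplus>k\<in>(UNIV :: 3 set). g k) = g 1 \<oplus> (g 2 \<oplus> g 3)"
proof -
  have "g \<in> A \<rightarrow> carrier R" for A
    using assms by auto
  then show ?thesis
    unfolding UNIV_3 using assms by (simp add: finsum_insert)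
qed

lemma H_mat_one: "\<one>\<^bsub>mat_ring R\<^esub> = H_mat R \<one> \<zero> \<one> \<zero> \<one>"
  by (simp add: mat_ring_def vec_eq_iff forall_3)

lemma H_mat_zero: "\<zero>\<^bsub>mat_ring R\<^esub> = H_mat R \<zero> \<zero> \<zero> \<zero> \<zero>"
  by (simp add: mat_ring_def vec_eq_iff forall_3)

lemma H_mat_add:
  assumes "{a, c, d, e, f} \<subseteq> carrier R" "{a', c', d', e', f'} \<subseteq> carrier R"
  shows "H_mat R a c d e f \<oplus>\<^bsub>mat_ring R\<^esub> H_mat R a' c' d' e' f' =
         H_mat R (a \<oplus> a') (c \<oplus> c') (d \<oplus> d') (e \<oplus> e') (f \<oplus> f')"
  using assms by (simp add: mat_ring_def vec_eq_iff forall_3)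

lemma H_mat_mult:
  assumes "{a, c, d, e, f} \<subseteq> carrier R" "{a', c', d', e', f'} \<subseteq> carrier R"
  shows "H_mat R a c d e f \<otimes>\<^bsub>mat_ring R\<^esub> H_mat R a' c' d' e' f' =
         H_mat R (a \<otimes> a') (c \<otimes> a' \<oplus> d \<otimes> c') (d \<otimes> d') (d \<otimes> e' \<oplus> e \<otimes> f') (f \<otimes> f')"
proof -
  have "H_mat R a c d e f $ i $ j \<in> carrier R" "H_mat R a' c' d' e' f' $ i $ j \<in> carrier R" for i j
    using H_mat_carrier [OF assms(1)] H_mat_carrier [OF assms(2)] by (auto simp: mat_ring_def)
  then show ?thesis
    using assms by (simp add: mat_ring_def vec_eq_iff forall_3 finsum_3)
qed

lemma H_mat_uminus:
  assumes "{a, c, d, e, f} \<subseteq> carrier R"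
  shows "\<ominus>\<^bsub>mat_ring R\<^esub> H_mat R a c d e f = H_mat R (\<ominus> a) (\<ominus> c) (\<ominus> d) (\<ominus> e) (\<ominus> f)"
proof -
  interpret M: ring "mat_ring R :: ('a^3^3) ring"
    by (rule mat_ring_is_ring)
  have cl: "{\<ominus> a, \<ominus> c, \<ominus> d, \<ominus> e, \<ominus> f} \<subseteq> carrier R"
    using assms by simp
  have "H_mat R (\<ominus> a) (\<ominus> c) (\<ominus> d) (\<ominus> e) (\<ominus> f) \<oplus>\<^bsub>mat_ring R\<^esub> H_mat R a c d e f =
        \<zero>\<^bsub>mat_ring R\<^esub>"
    using assms unfolding H_mat_add [OF cl assms] H_mat_zero by (simp add: l_neg)
  then show ?thesis
    by (rule M.minus_equality [OF _ H_mat_carrier [OF assms] H_mat_carrier [OF cl]])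
qed

lemma diff_add_diff:
  assumes "{a, b, c, d} \<subseteq> carrier R"
  shows "(a \<oplus> b) \<ominus> (c \<oplus> d) = (a \<ominus> c) \<oplus> (b \<ominus> d)"
  using assms by (simp add: minus_eq minus_add a_ac)

lemma diff_mult_left:
  assumes "{a, b, c, d} \<subseteq> carrier R"
  shows "a \<otimes> b \<ominus> c \<otimes> d = (a \<ominus> c) \<otimes> b \<oplus> c \<otimes> (b \<ominus> d)"
  using assms by (simp add: minus_eq l_distr r_distr l_minus r_minus a_assoc r_neg1)

lemma diff_mult_right:
  assumes "{a, b, c, d} \<subseteq> carrier R"
  shows "a \<otimes> b \<ominus> c \<otimes> d = a \<otimes> (b \<ominus> d) \<oplus> (a \<ominus> c) \<otimes> d"
  using assms by (simp add: minus_eq l_distr r_distr l_minus r_minus a_assoc r_neg1)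

lemma H_setE:
  assumes "X \<in> H_set R s t"
  obtains a c d e f where "X = H_mat R a c d e f" "{a, c, d, e, f} \<subseteq> carrier R"
    "a \<ominus> d = s \<otimes> c" "d \<ominus> f = t \<otimes> e"
  using assms unfolding H_set_def by blast

lemma H_setI:
  assumes "{a, c, d, e, f} \<subseteq> carrier R" "a \<ominus> d = s \<otimes> c" "d \<ominus> f = t \<otimes> e"
  shows "H_mat R a c d e f \<in> H_set R s t"
  using assms unfolding H_set_def by blast

lemma H_set_one:
  assumes "s \<in> carrier R" "t \<in> carrier R"
  shows "\<one>\<^bsub>mat_ring R\<^esub> \<in> H_set R s t"
  unfolding H_mat_one using assms by (intro H_setI) (auto simp: minus_eq r_neg)

lemma H_set_uminus:
  assumes "s \<in> carrier R" "t \<in> carrier R" "X \<in> H_set R s t"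
  shows "\<ominus>\<^bsub>mat_ring R\<^esub> X \<in> H_set R s t"
proof -
  obtain a c d e f where X: "X = H_mat R a c d e f" and cl: "{a, c, d, e, f} \<subseteq> carrier R"
      and eq: "a \<ominus> d = s \<otimes> c" "d \<ominus> f = t \<otimes> e"
    using assms(3) by (rule H_setE)
  have neg: "\<ominus> x \<ominus> \<ominus> y = \<ominus> (x \<ominus> y)" if "x \<in> carrier R" "y \<in> carrier R" for x y
    using that by (simp add: minus_eq minus_add)
  show ?thesis
    unfolding X H_mat_uminus [OF cl]
    using cl assms(1,2) eq by (intro H_setI) (simp_all add: neg r_minus)
qed

lemma H_set_add:
  assumes "s \<in> carrier R" "t \<in> carrier R" "X \<in> H_set R s t" "Y \<in> H_set R s t"
  shows "X \<oplus>\<^bsub>mat_ring R\<^esub> Y \<in> H_set R s t"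
proof -
  obtain a c d e f where X: "X = H_mat R a c d e f" and cl: "{a, c, d, e, f} \<subseteq> carrier R"
      and eq: "a \<ominus> d = s \<otimes> c" "d \<ominus> f = t \<otimes> e"
    using assms(3) by (rule H_setE)
  obtain a' c' d' e' f' where Y: "Y = H_mat R a' c' d' e' f'"
      and cl': "{a', c', d', e', f'} \<subseteq> carrier R"
      and eq': "a' \<ominus> d' = s \<otimes> c'" "d' \<ominus> f' = t \<otimes> e'"
    using assms(4) by (rule H_setE)
  show ?thesis
    unfolding X Y H_mat_add [OF cl cl']
    using cl cl' assms(1,2) eq eq' by (intro H_setI) (simp_all add: diff_add_diff r_distr)
qed

lemma H_set_mult:
  assumes "s \<in> ring_center R" "t \<in> ring_center R" "X \<in> H_set R s t" "Y \<in> H_set R s t"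
  shows "X \<otimes>\<^bsub>mat_ring R\<^esub> Y \<in> H_set R s t"
proof -
  have st: "s \<in> carrier R" "t \<in> carrier R"
    using assms by (auto simp: ring_center_def)
  obtain a c d e f where X: "X = H_mat R a c d e f" and cl: "{a, c, d, e, f} \<subseteq> carrier R"
      and eq: "a \<ominus> d = s \<otimes> c" "d \<ominus> f = t \<otimes> e"
    using assms(3) by (rule H_setE)
  obtain a' c' d' e' f' where Y: "Y = H_mat R a' c' d' e' f'"
      and cl': "{a', c', d', e', f'} \<subseteq> carrier R"
      and eq': "a' \<ominus> d' = s \<otimes> c'" "d' \<ominus> f' = t \<otimes> e'"
    using assms(4) by (rule H_setE)
  have central: "x \<otimes> (z \<otimes> y) = z \<otimes> (x \<otimes> y)"
    if "z \<in> ring_center R" "x \<in> carrier R" "y \<in> carrier R" for x y z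
  proof -
    have "z \<otimes> x = x \<otimes> z" "z \<in> carrier R"
      using that by (auto simp: ring_center_def)
    then show ?thesis
      using that by (metis m_assoc)
  qed
  have "a \<otimes> a' \<ominus> d \<otimes> d' = s \<otimes> (c \<otimes> a' \<oplus> d \<otimes> c')"
    using cl cl' st
    by (simp add: diff_mult_left eq eq' r_distr m_assoc central [OF assms(1)])
  moreover have "d \<otimes> d' \<ominus> f \<otimes> f' = t \<otimes> (d \<otimes> e' \<oplus> e \<otimes> f')"
    using cl cl' st
    by (simp add: diff_mult_right eq eq' r_distr m_assoc central [OF assms(2)])
  ultimately show ?thesis
    unfolding X Y H_mat_mult [OF cl cl'] using cl cl' by (intro H_setI) simp_all
qed

lemma H_set_subring:
  assumes s: "s \<in> ring_center R" and t: "t \<in> ring_center R"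
  shows "subring (H_set R s t) (mat_ring R)"
proof (rule ring.subringI [OF mat_ring_is_ring])
  have st: "s \<in> carrier R" "t \<in> carrier R"
    using s t by (auto simp: ring_center_def)
  show "H_set R s t \<subseteq> carrier (mat_ring R)"
    by (auto elim!: H_setE intro!: H_mat_carrier)
  show "\<one>\<^bsub>mat_ring R\<^esub> \<in> H_set R s t"
    using st by (rule H_set_one)
  show "\<ominus>\<^bsub>mat_ring R\<^esub> X \<in> H_set R s t" if "X \<in> H_set R s t" for X
    using st that by (rule H_set_uminus)
  show "X \<oplus>\<^bsub>mat_ring R\<^esub> Y \<in> H_set R s t" if "X \<in> H_set R s t" "Y \<in> H_set R s t" for X Y
    using st that by (rule H_set_add)
  show "X \<otimes>\<^bsub>mat_ring R\<^esub> Y \<in> H_set R s t" if "X \<in> H_set R s t" "Y \<in> H_set R s t" for X Y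
    using s t that by (rule H_set_mult)
qed

lemma H_ring_is_ring:
  assumes "s \<in> ring_center R" "t \<in> ring_center R"
  shows "ring (H_ring R s t)"
  unfolding H_ring_def
  using ring.subring_is_ring [OF mat_ring_is_ring H_set_subring [OF assms]] .

end

end

theory Submission
  imports Defs "HOL-Algebra.Chinese_Remainder"
begin

text \<open>
  As \<open>s\<close> and \<open>t\<close> are units, the entries \<open>c\<close> and \<open>e\<close> of an element of \<open>H_ring R s t\<close> are
  determined by its diagonal, so that the diagonal is an isomorphism onto the product of three
  copies of \<open>R\<close>. All notions involved in \<open>\<Delta>\<close>-quasipolarity are computed componentwise in a product.
\<close>

lemma ring_iso_Units_iff:
  assumes h: "h \<in> ring_iso R S" and "ring R" "x \<in> carrier R"
  shows "h x \<in> Units S \<longleftrightarrow> x \<in> Units R"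
proof -
  interpret R: ring R by fact
  have inj: "inj_on h (carrier R)" and S: "carrier S = h ` carrier R"
    using ring_iso_memE(5) [OF h] by (auto simp: bij_betw_def)
  \<comment> \<open>Injectivity of \<open>h\<close> reflects equations with value one. As
    \<open>h\<close> is onto, every candidate inverse in \<open>S\<close> is some
    \<open>h y\<close>.\<close>
  have "h x \<otimes>\<^bsub>S\<^esub> h y = \<one>\<^bsub>S\<^esub> \<longleftrightarrow> x \<otimes>\<^bsub>R\<^esub> y = \<one>\<^bsub>R\<^esub>"
    "h y \<otimes>\<^bsub>S\<^esub> h x = \<one>\<^bsub>S\<^esub> \<longleftrightarrow> y \<otimes>\<^bsub>R\<^esub> x = \<one>\<^bsub>R\<^esub>" if "y \<in> carrier R" for y
    using that assms(3) inj_on_eq_iff [OF inj]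
    by (simp_all add: ring_iso_memE(2,4) [OF h, symmetric])
  then show ?thesis
    using assms(3) by (auto simp: Units_def S)
qed

text \<open>The units of \<open>S\<close> are exactly the images of the units of \<open>R\<close>,
  so the quantifier over \<open>Units S\<close> pulls back to \<open>Units R\<close>.\<close>

lemma ring_iso_Delta_iff:
  assumes h: "h \<in> ring_iso R S" and "ring R" "x \<in> carrier R"
  shows "h x \<in> Delta S \<longleftrightarrow> x \<in> Delta R"
proof -
  interpret R: ring R by fact
  have S: "carrier S = h ` carrier R"
    using ring_iso_memE(5) [OF h] by (auto simp: bij_betw_def)
  have Units_S: "Units S = h ` Units R"
    using ring_iso_Units_iff [OF h assms(2)] R.Units_closed
    by (auto simp: S Units_def [of S])
  have "h x \<oplus>\<^bsub>S\<^esub> h u \<in> Units S \<longleftrightarrow> x \<oplus>\<^bsub>R\<^esub> u \<in> Units R" if "u \<in> Units R" for u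
    using that assms(3) ring_iso_Units_iff [OF h assms(2), of "x \<oplus>\<^bsub>R\<^esub> u"]
    by (simp add: ring_iso_memE(3) [OF h] R.Units_closed)
  then show ?thesis
    using assms(3) by (auto simp: Delta_def Units_S S)
qed

text \<open>By injectivity \<open>h\<close> reflects commutation as well as preserving it. Hence
  anything commuting with \<open>h a\<close> is \<open>h x\<close> for some \<open>x\<close>
  commuting with \<open>a\<close>, and such an \<open>x\<close> commutes with
  \<open>p\<close>.\<close>

lemma ring_iso_comm2:
  assumes h: "h \<in> ring_iso R S" and "ring R" "a \<in> carrier R" "p \<in> comm2 R a"
  shows "h p \<in> comm2 S (h a)"
proof -
  interpret R: ring R by fact
  have inj: "inj_on h (carrier R)" and S: "carrier S = h ` carrier R"
    using ring_iso_memE(5) [OF h] by (auto simp: bij_betw_def)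
  have commute: "h x \<otimes>\<^bsub>S\<^esub> h y = h y \<otimes>\<^bsub>S\<^esub> h x \<longleftrightarrow> x \<otimes>\<^bsub>R\<^esub> y = y \<otimes>\<^bsub>R\<^esub> x"
    if "x \<in> carrier R" "y \<in> carrier R" for x y
    using that inj_on_eq_iff [OF inj] by (simp add: ring_iso_memE(2) [OF h, symmetric])
  show ?thesis
    using assms(3,4) commute by (auto simp: comm2_def comm_def S)
qed

lemma ring_iso_Delta_quasipolar:
  assumes h: "h \<in> ring_iso R S" and "ring R" "Delta_quasipolar R"
  shows "Delta_quasipolar S"
  unfolding Delta_quasipolar_def
proof
  interpret R: ring R by fact
  fix b assume "b \<in> carrier S"
  then obtain a where a: "a \<in> carrier R" "b = h a"
    using ring_iso_memE(5) [OF h] by (auto simp: bij_betw_def)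
  obtain p where p: "p \<in> comm2 R a" "p \<otimes>\<^bsub>R\<^esub> p = p" "a \<oplus>\<^bsub>R\<^esub> p \<in> Delta R"
    using assms(3) a(1) by (auto simp: Delta_quasipolar_def Delta_quasipolar_elem_def)
  then have "p \<in> carrier R"
    by (simp add: comm2_def)
  then have "h p \<otimes>\<^bsub>S\<^esub> h p = h p" "b \<oplus>\<^bsub>S\<^esub> h p \<in> Delta S"
    using p a ring_iso_Delta_iff [OF h assms(2)]
    by (simp_all add: ring_iso_memE(2,3) [OF h, symmetric])
  then show "Delta_quasipolar_elem S b"
    using ring_iso_comm2 [OF h assms(2) a(1) p(1)] a(2)
    by (auto simp: Delta_quasipolar_elem_def)
qed

text \<open>The backward direction transports along the inverse isomorphism.\<close>

lemma ring_iso_Delta_quasipolar_iff: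
  assumes "h \<in> ring_iso R S" "ring R" "ring S"
  shows "Delta_quasipolar R \<longleftrightarrow> Delta_quasipolar S"
  using ring_iso_Delta_quasipolar assms ring_iso_set_sym by metis

lemma RDirProd_simps:
  "(a, b) \<otimes>\<^bsub>RDirProd R S\<^esub> (c, d) = (a \<otimes>\<^bsub>R\<^esub> c, b \<otimes>\<^bsub>S\<^esub> d)"
  "(a, b) \<oplus>\<^bsub>RDirProd R S\<^esub> (c, d) = (a \<oplus>\<^bsub>R\<^esub> c, b \<oplus>\<^bsub>S\<^esub> d)"
  "\<one>\<^bsub>RDirProd R S\<^esub> = (\<one>\<^bsub>R\<^esub>, \<one>\<^bsub>S\<^esub>)"
  by (simp_all add: RDirProd_def DirProd_def monoid.defs)

lemma Units_RDirProd: "Units (RDirProd R S) = Units R \<times> Units S"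
  unfolding Units_def RDirProd_carrier by (auto simp: RDirProd_simps) blast

lemma Delta_RDirProd:
  assumes "ring R" "ring S"
  shows "Delta (RDirProd R S) = Delta R \<times> Delta S"
proof -
  \<comment> \<open>A unit of one factor is padded with one in the other to give a unit of the
    product, so each component can be tested alone.\<close>
  have "\<one>\<^bsub>R\<^esub> \<in> Units R" "\<one>\<^bsub>S\<^esub> \<in> Units S"
    using assms by (auto intro!: monoid.Units_one_closed simp: ring.is_monoid)
  then show ?thesis
    by (fastforce simp: Delta_def Units_RDirProd RDirProd_carrier RDirProd_simps)
qed

lemma comm_RDirProd: "comm (RDirProd R S) (a, b) = comm R a \<times> comm S b"
  by (auto simp: comm_def RDirProd_carrier RDirProd_simps)

lemma comm2_RDirProd:
  assumes "ring R" "ring S" "a \<in> carrier R" "b \<in> carrier S"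
  shows "comm2 (RDirProd R S) (a, b) = comm2 R a \<times> comm2 S b"
proof -
  \<comment> \<open>Padding again: an element of \<open>comm R a\<close> is paired with
    \<open>b\<close>, and one of \<open>comm S b\<close> with \<open>a\<close>.\<close>
  have "a \<in> comm R a" "b \<in> comm S b"
    using assms by (auto simp: comm_def)
  then show ?thesis
    by (fastforce simp: comm2_def comm_RDirProd RDirProd_carrier RDirProd_simps)
qed

lemma Delta_quasipolar_RDirProd:
  assumes "ring R" "ring S"
  shows "Delta_quasipolar (RDirProd R S) \<longleftrightarrow> Delta_quasipolar R \<and> Delta_quasipolar S"
proof -
  have elem: "Delta_quasipolar_elem (RDirProd R S) (a, b) \<longleftrightarrow>
      Delta_quasipolar_elem R a \<and> Delta_quasipolar_elem S b"
    if "a \<in> carrier R" "b \<in> carrier S" for a b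
    using that assms
    by (auto simp: Delta_quasipolar_elem_def comm2_RDirProd Delta_RDirProd RDirProd_simps)
  \<comment> \<open>With zero in the other component, every element of a factor occurs in the
    product; this gives the forward direction.\<close>
  have "\<zero>\<^bsub>R\<^esub> \<in> carrier R" "\<zero>\<^bsub>S\<^esub> \<in> carrier S"
    using assms by (auto intro: ring.ring_simprules)
  then show ?thesis
    by (auto simp: Delta_quasipolar_def RDirProd_carrier elem)
qed

context ring
begin

lemma H_mat_ext:
  assumes "s \<in> Units R" "t \<in> Units R" "X \<in> H_set R s t" "Y \<in> H_set R s t"
    and eq: "X $ 1 $ 1 = Y $ 1 $ 1" "X $ 2 $ 2 = Y $ 2 $ 2" "X $ 3 $ 3 = Y $ 3 $ 3"
  shows "X = Y"
proof -
  obtain a c d e f where X: "X = H_mat R a c d e f" and cl: "{a, c, d, e, f} \<subseteq> carrier R"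
      and X_eq: "a \<ominus> d = s \<otimes> c" "d \<ominus> f = t \<otimes> e"
    using assms(3) by (rule H_setE)
  \<comment> \<open>The diagonals agree, so both matrices solve the same two equations for their
    off-diagonal entries, and the units \<open>s\<close> and \<open>t\<close> cancel.\<close>
  obtain c' e' where Y: "Y = H_mat R a c' d e' f" and cl': "{c', e'} \<subseteq> carrier R"
      and Y_eq: "a \<ominus> d = s \<otimes> c'" "d \<ominus> f = t \<otimes> e'"
    using assms(4) eq unfolding X by (elim H_setE) auto
  have "s \<otimes> c = s \<otimes> c'" "t \<otimes> e = t \<otimes> e'"
    using X_eq Y_eq by simp_all
  then have "c = c'" "e = e'"
    using cl cl' assms(1,2) by simp_all
  then show ?thesis
    by (simp add: X Y)
qed

text \<open>Solving the two defining equations for \<open>c\<close> and \<open>e\<close> completes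
  any prescribed diagonal, whence surjectivity of the diagonal map.\<close>

lemma H_mat_exists:
  assumes "s \<in> Units R" "t \<in> Units R" "{a, d, f} \<subseteq> carrier R"
  shows "H_mat R a (inv s \<otimes> (a \<ominus> d)) d (inv t \<otimes> (d \<ominus> f)) f \<in> H_set R s t"
proof -
  have "u \<otimes> (inv u \<otimes> x) = x" if "u \<in> Units R" "x \<in> carrier R" for u x
    using that by (metis Units_closed Units_inv_closed Units_r_inv l_one m_assoc)
  then show ?thesis
    using assms by (intro H_setI) auto
qed

lemma H_set_diagonal:
  assumes "s \<in> Units R" "t \<in> Units R"
  shows "(\<lambda>X. (X $ 1 $ 1, X $ 2 $ 2, X $ 3 $ 3)) ` H_set R s t =
    carrier R \<times> carrier R \<times> carrier R"
    (is "?h ` _ = _")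
proof (intro subset_antisym subsetI)
  fix x assume "x \<in> ?h ` H_set R s t"
  then obtain X where "X \<in> H_set R s t" "x = ?h X"
    by blast
  then show "x \<in> carrier R \<times> carrier R \<times> carrier R"
    by (elim H_setE) simp
next
  fix x assume "x \<in> carrier R \<times> carrier R \<times> carrier R"
  then obtain a d f where x: "x = (a, d, f)" "{a, d, f} \<subseteq> carrier R"
    by auto
  show "x \<in> ?h ` H_set R s t"
    by (rule image_eqI [OF _ H_mat_exists [OF assms x(2)]]) (simp add: x(1))
qed

text \<open>The diagonal is multiplicative although the matrices are not triangular: rows 1 and 3
  vanish off the diagonal, so the entries \<open>c\<close> and \<open>e\<close> never contribute to
  the diagonal of a product.\<close>

lemma diagonal_ring_iso:
  assumes "s \<in> Units R" "t \<in> Units R"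
  shows "(\<lambda>X. (X $ 1 $ 1, X $ 2 $ 2, X $ 3 $ 3))
    \<in> ring_iso (H_ring R s t) (RDirProd R (RDirProd R R))" (is "?h \<in> ring_iso ?H ?P")
proof -
  have "?h (X \<otimes>\<^bsub>?H\<^esub> Y) = ?h X \<otimes>\<^bsub>?P\<^esub> ?h Y"
    "?h (X \<oplus>\<^bsub>?H\<^esub> Y) = ?h X \<oplus>\<^bsub>?P\<^esub> ?h Y"
    if HX: "X \<in> H_set R s t" and HY: "Y \<in> H_set R s t" for X Y
  proof -
    obtain a c d e f where X: "X = H_mat R a c d e f" "{a, c, d, e, f} \<subseteq> carrier R"
      using HX by (rule H_setE)
    obtain a' c' d' e' f' 
      where Y: "Y = H_mat R a' c' d' e' f'" "{a', c', d', e', f'} \<subseteq> carrier R"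
      using HY by (rule H_setE)
    show "?h (X \<otimes>\<^bsub>?H\<^esub> Y) = ?h X \<otimes>\<^bsub>?P\<^esub> ?h Y"
      "?h (X \<oplus>\<^bsub>?H\<^esub> Y) = ?h X \<oplus>\<^bsub>?P\<^esub> ?h Y"
      by (simp_all add: X(1) Y(1) H_ring_def H_mat_mult [OF X(2) Y(2)] H_mat_add [OF X(2) Y(2)]
          RDirProd_simps)
  qed
  moreover have "?h \<one>\<^bsub>?H\<^esub> = \<one>\<^bsub>?P\<^esub>"
    by (simp add: H_ring_def H_mat_one RDirProd_simps)
  moreover have "inj_on ?h (H_set R s t)"
    using H_mat_ext [OF assms] by (auto intro!: inj_onI)
  then have bij: "bij_betw ?h (H_set R s t) (carrier ?P)"
    using H_set_diagonal [OF assms] by (simp add: bij_betw_def RDirProd_carrier)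
  \<comment> \<open>This supplies the condition in \<open>ring_hom\<close> that the map lands in the
    carrier of the product.\<close>
  moreover note bij_betw_apply [OF bij]
  ultimately show ?thesis
    unfolding ring_iso_def ring_hom_def by (auto simp: H_ring_def)
qed

end

theorem theorem2p27:
  fixes R :: "('a, 'm) ring_scheme" and s t :: 'a
  assumes "ring R"
    and "s \<in> ring_center R \<inter> Units R"
    and "t \<in> ring_center R \<inter> Units R"
  shows "Delta_quasipolar (H_ring R s t) \<longleftrightarrow> Delta_quasipolar R"
proof -
  interpret R: ring R by fact
  \<comment> \<open>Centrality of \<open>s\<close> and \<open>t\<close> enters here: it makes
    \<open>H_set R s t\<close> closed under multiplication.\<close>
  have "ring (H_ring R s t)"
    using assms by (intro R.H_ring_is_ring) auto
  moreover have "ring (RDirProd R R)" "ring (RDirProd R (RDirProd R R))"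
    using assms(1) by (intro RDirProd_ring; assumption)+
  \<comment> \<open>The product lemma, applied to both nested products, leaves three copies of the
    same condition on \<open>R\<close>.\<close>
  ultimately show ?thesis
    using ring_iso_Delta_quasipolar_iff [OF R.diagonal_ring_iso] assms
    by (simp add: Delta_quasipolar_RDirProd)
qed

end
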